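(* Let $t\ge2$ be an integer and $v$ a positive integer with $v\equiv\pm1\pmod{3t}$ and $v>6t+53$. Then every multiset of size $v-1$ with support $\{1,3,3t\}$ is realizable.
   Context: $K_v$ is the complete graph on vertex set $\{0,\dots,v-1\}$; the length of an edge $\{u,w\}$ is $\min(|u-w|,v-|u-w|)$. A multiset $L$ of size $v-1$ is realizable if some Hamiltonian path in $K_v$ has multiset of edge lengths equal to $L$. The support of a multiset is its set of distinct elements. (The paper phrases this as: the Buratti–Horak–Rosa Conjecture holds for $\{1,3,3t\}$ at such $v$; under these conditions the divisibility condition of that conjecture is vacuous, so this means exactly that all such multisets are realizable.) *)

theory Defs
  imports
    "HOL-Library.Multiset"
    "HOL-Number_Theory.Cong"
    "Graph_Theory.Pair_Digraph"
    "Graph_Theory.Vertex_Walk"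
    "Graph_Theory.Kuratowski"
begin

text \<open>
  Undirected graphs are symmetric digraphs here, as everywhere in Graph_Theory: each edge
  of the complete graph is represented by two opposite arcs.
\<close>

definition complete_graph :: "nat \<Rightarrow> nat pair_pre_digraph" where
  "complete_graph v =
     \<lparr> pverts = {0..<v}, parcs = {(u, w). u \<in> {0..<v} \<and> w \<in> {0..<v} \<and> u \<noteq> w} \<rparr>"

lemma complete_digraph_complete_graph: "complete_digraph v (with_proj (complete_graph v))"
  unfolding complete_digraph_pair_def by (auto simp: complete_graph_def)

definition hamiltonian_path :: "'a list \<Rightarrow> ('a, 'b) pre_digraph \<Rightarrow> bool" where
  "hamiltonian_path p G \<longleftrightarrow> vpath p G \<and> set p = verts G"

text \<open>
  The difference is taken in the integers, since subtraction on the naturals truncates.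
  For distinct \<open>u\<close> and \<open>w\<close> below \<open>v\<close> the subtraction from \<open>v\<close> does not truncate.
\<close>

definition edge_length :: "nat \<Rightarrow> nat \<Rightarrow> nat \<Rightarrow> nat" where
  "edge_length v u w = min (nat \<bar>int u - int w\<bar>) (v - nat \<bar>int u - int w\<bar>)"

lemma edge_length_commute: "edge_length v u w = edge_length v w u"
  by (simp add: edge_length_def abs_minus_commute)

definition path_lengths :: "nat \<Rightarrow> nat list \<Rightarrow> nat multiset" where
  "path_lengths v p = image_mset (\<lambda>(u, w). edge_length v u w) (mset (vwalk_arcs p))"

definition realizable :: "nat \<Rightarrow> nat multiset \<Rightarrow> bool" where
  "realizable v L \<longleftrightarrow>
     (\<exists>p. hamiltonian_path p (with_proj (complete_graph v)) \<and> path_lengths v p = L)"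

end

theory Submission
  imports Defs
begin

text \<open>
  Write \<open>v = 3 t k \<plusminus> 1\<close>. Multiplication by 3 turns the lengths \<open>t k, 1, t\<close> modulo \<open>v\<close>
  into \<open>1, 3, 3 t\<close>, and multiplication by \<open>3 t\<close> does the same to \<open>k, 3 k, 1\<close>.
  Zigzags through the residue classes modulo \<open>x\<close> and modulo \<open>y\<close> on adjacent intervals give a
  Hamiltonian path of \<open>{0..<v}\<close>, with lengths measured in the integers, for every multiset of
  lengths \<open>1, x, y\<close> in which 1 occurs at least \<open>x + y + 1\<close> times. So the multiset is realizable
  if the multiplicity of 1, 3 or \<open>3 t\<close> is more than \<open>3 + 3 t\<close>, \<open>t + t k\<close> or \<open>4 k\<close>
  respectively. For \<open>t \<ge> 3\<close> these three conditions cannot all fail. For \<open>t = 2\<close> what remains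
  is \<open>{1, 2, 2 k}\<close> with at most nine edges of length \<open>2 k\<close>, and these fit into a ladder.
\<close>

lemma replicate_mset_plus: "replicate_mset (m + n) x = replicate_mset m x + replicate_mset n x"
  by (induction m) simp_all

section \<open>Tours of finite sets of integers\<close>

text \<open>The path grows only at its front \<open>u\<close>. \<open>M\<close> records plain
  integer differences, with no modulus, so that the same tour can later be multiplied by any unit
  modulo \<open>v\<close>.\<close>

inductive tour :: "int set \<Rightarrow> int \<Rightarrow> int \<Rightarrow> nat multiset \<Rightarrow> bool" where
  single: "tour {u} u u {#}"
| step: "tour S u w M \<Longrightarrow> z \<notin> S \<Longrightarrow> tour (insert z S) z w (add_mset (nat \<bar>z - u\<bar>) M)"

lemma tour_append:
  assumes "tour S u w M" "tour S' u' w' M'" "S \<inter> S' = {}"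
  shows "tour (S \<union> S') u w' (add_mset (nat \<bar>w - u'\<bar>) (M + M'))"
  using assms
proof (induction rule: tour.induct)
  case (single u)
  then show ?case using tour.step[of S' u' w' M' u] by simp
next
  case (step S u w M z)
  have "tour (S \<union> S') u w' (add_mset (nat \<bar>w - u'\<bar>) (M + M'))"
    using step by auto
  moreover have "z \<notin> S \<union> S'" using step by auto
  ultimately have "tour (insert z (S \<union> S')) z w'
      (add_mset (nat \<bar>z - u\<bar>) (add_mset (nat \<bar>w - u'\<bar>) (M + M')))"
    by (intro tour.step)
  then show ?case by (simp add: add_mset_commute)
qed

lemma tour_rev: "tour S u w M \<Longrightarrow> tour S w u M"
proof (induction rule: tour.induct)
  case (single u)
  then show ?case by (rule tour.single)
next
  case (step S u w M z)
  have "tour (S \<union> {z}) w z (add_mset (nat \<bar>u - z\<bar>) (M + {#}))"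
    by (rule tour_append[OF step.IH tour.single]) (use step in auto)
  then show ?case by (simp add: abs_minus_commute)
qed

lemma tour_isometry:
  assumes "tour S u w M" and "\<And>x y. \<bar>f x - f y\<bar> = \<bar>x - y\<bar>"
  shows "tour (f ` S) (f u) (f w) M"
  using assms(1)
proof (induction rule: tour.induct)
  case (single u)
  then show ?case by (simp add: tour.single)
next
  case (step S u w M z)
  have "f z \<notin> f ` S"
  proof
    assume "f z \<in> f ` S"
    then obtain s where "s \<in> S" "f z = f s" by auto
    then have "\<bar>z - s\<bar> = 0" using assms(2)[of z s] by simp
    then show False using \<open>s \<in> S\<close> step.hyps by simp
  qed
  from tour.step[OF step.IH this] show ?case by (simp add: assms(2))
qed

lemma tour_translate:
  assumes "tour {l..<h} u w M"
  shows "tour {l + d..<h + d} (u + d) (w + d) M"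
  using tour_isometry[OF assms, of "\<lambda>x. x + d"] by simp

lemma tour_reflect:
  assumes "tour {0..<h} u w M"
  shows "tour {0..<h} (h - 1 - u) (h - 1 - w) M"
proof -
  have "(\<lambda>x. h - 1 - x) ` {0..<h} = {0..<h}"
  proof (intro equalityI subsetI)
    fix y assume "y \<in> {0..<h}"
    then show "y \<in> (\<lambda>x. h - 1 - x) ` {0..<h}" by (intro image_eqI[of _ _ "h - 1 - y"]) auto
  qed auto
  then show ?thesis using tour_isometry[OF assms, of "\<lambda>x. h - 1 - x"] by simp
qed

lemma tour_memb: "tour S u w M \<Longrightarrow> u \<in> S \<and> w \<in> S"
  by (induction rule: tour.induct) auto

text \<open>Counting vertices counts edges. The constructions below may thus leave the number of
  steps of length \<open>x\<close> open and recover it at the end.\<close>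

lemma tour_card: "tour S u w M \<Longrightarrow> finite S \<and> card S = Suc (size M)"
  by (induction rule: tour.induct) auto

lemma tour_progression:
  assumes "0 < d"
  shows "tour ((\<lambda>i. u + int d * int i) ` {..n}) u (u + int d * int n) (replicate_mset n d)"
proof (induction n)
  case 0
  then show ?case by (simp add: tour.single)
next
  case (Suc n)
  let ?z = "u + int d * int (Suc n)"
  have "?z \<notin> (\<lambda>i. u + int d * int i) ` {..n}" using assms by auto
  from tour.step[OF tour_rev[OF Suc.IH] this]
  have "tour (insert ?z ((\<lambda>i. u + int d * int i) ` {..n})) ?z u
      (add_mset (nat \<bar>?z - (u + int d * int n)\<bar>) (replicate_mset n d))" .
  moreover have "nat \<bar>?z - (u + int d * int n)\<bar> = d" by (simp add: algebra_simps)
  ultimately have "tour (insert ?z ((\<lambda>i. u + int d * int i) ` {..n})) ?z u (replicate_mset (Suc n) d)"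
    by simp
  from tour_rev[OF this] show ?case by (simp add: atMost_Suc)
qed

lemma tour_interval:
  "tour {u..<u + int (Suc n)} u (u + int n) (replicate_mset n 1)"
proof -
  have "(\<lambda>i. u + int i) ` {..n} = {u..<u + int (Suc n)}"
  proof (intro equalityI subsetI)
    fix y assume "y \<in> {u..<u + int (Suc n)}"
    then show "y \<in> (\<lambda>i. u + int i) ` {..n}" by (intro image_eqI[of _ _ "nat (y - u)"]) auto
  qed auto
  then show ?thesis using tour_progression[of 1 u n] by simp
qed

text \<open>Surplus edges of length 1 become a run of unit steps in front, which is one reason why
  tours with two lengths are made to start at \<open>0\<close>.\<close>

lemma tour_prepend_ones:
  assumes "tour {0..<int N} 0 w M"
  shows "tour {0..<int (N + k)} 0 (w + int k) (replicate_mset k 1 + M)"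
proof (cases k)
  case 0
  then show ?thesis using assms by simp
next
  case (Suc j)
  have "tour {int k..<int N + int k} (int k) (w + int k) M"
    using tour_translate[OF assms, of "int k"] by simp
  from tour_append[OF tour_interval[of 0 j] this]
  have "tour ({0..<int (Suc j)} \<union> {int k..<int N + int k}) 0 (w + int k)
      (add_mset 1 (replicate_mset j 1 + M))"
    using Suc by simp
  moreover have "{0..<int (Suc j)} \<union> {int k..<int N + int k} = {0..<int (N + k)}"
    using Suc by auto
  ultimately show ?thesis using Suc by simp
qed

section \<open>Two edge lengths\<close>

text \<open>The two bounds on \<open>h\<close> say that \<open>l + x n\<close> is the last member of
  the class below \<open>h\<close>. The lower end \<open>l\<close> is arbitrary so that a class can
  also be cut into two pieces.\<close>

lemma tour_class:
  assumes "0 < x" "l mod int x = i" "l + int x * int n < h" "h \<le> l + int x * int n + int x"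
  shows "tour {z \<in> {l..<h}. z mod int x = i} l (l + int x * int n) (replicate_mset n x)"
proof -
  have "(\<lambda>k. l + int x * int k) ` {..n} = {z \<in> {l..<h}. z mod int x = i}"
  proof (intro equalityI subsetI)
    fix z assume "z \<in> (\<lambda>k. l + int x * int k) ` {..n}"
    then obtain k where k: "k \<le> n" "z = l + int x * int k" by auto
    have "int x * int k \<le> int x * int n" using k by (simp add: mult_left_mono)
    moreover have "0 \<le> int x * int k" by simp
    ultimately show "z \<in> {z \<in> {l..<h}. z mod int x = i}" using assms(2,3) k(2) by auto
  next
    fix z assume z: "z \<in> {z \<in> {l..<h}. z mod int x = i}"
    then have "z mod int x = l mod int x" using assms(2) by simp
    then have "int x dvd z - l" by (simp only: mod_eq_dvd_iff)
    then obtain k where k: "z - l = int x * k" by blast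
    have "0 \<le> int x * k" using z k by simp
    then have "0 \<le> k" using assms(1) by (simp add: zero_le_mult_iff)
    have "int x * k < int x * (int n + 1)" using z assms(4) k by (simp add: algebra_simps)
    then have "k < int n + 1" using assms(1) by (simp add: mult_less_cancel_left)
    then show "z \<in> (\<lambda>k. l + int x * int k) ` {..n}"
      using k \<open>0 \<le> k\<close> by (intro image_eqI[of _ _ "nat k"]) auto
  qed
  then show ?thesis using tour_progression[OF assms(1), of l n] by simp
qed

lemma tour_column:
  assumes "0 < x" "i < x" "x \<le> N"
  shows "tour {z \<in> {0..<int N}. z mod int x = int i} (int i)
    (int i + int x * int ((N - 1 - i) div x)) (replicate_mset ((N - 1 - i) div x) x)"
proof -
  let ?h = "(N - 1 - i) div x"
  have "x * ?h + (N - 1 - i) mod x = N - 1 - i" "(N - 1 - i) mod x < x"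
    using assms(1) by (simp_all add: mult_div_mod_eq)
  then have "i + x * ?h < N" "N \<le> i + x * ?h + x" using assms by linarith+
  then have "int (i + x * ?h) < int N" "int N \<le> int (i + x * ?h + x)" by linarith+
  then have T: "tour {z \<in> {int i..<int N}. z mod int x = int i} (int i)
      (int i + int x * int ?h) (replicate_mset ?h x)"
    using assms by (intro tour_class) (simp_all del: of_nat_div)
  have "z mod int x \<le> z" if "0 \<le> z" for z
    using that by (simp add: zmod_le_nonneg_dividend)
  then have "{z \<in> {int i..<int N}. z mod int x = int i} = {z \<in> {0..<int N}. z mod int x = int i}"
    by force
  with T show ?thesis by simp
qed

text \<open>With \<open>N = x q + r\<close>, the classes below \<open>r\<close> have height
  \<open>q\<close> and the others \<open>q - 1\<close>. As \<open>r\<close> and \<open>j\<close> are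
  even, the drop never falls between \<open>j\<close> and \<open>Suc j\<close>.\<close>

lemma column_height_eq:
  assumes x: "0 < x" "x \<le> N" and ev: "even (N mod x)" and j: "even j" "Suc j < x"
  shows "(N - 1 - Suc j) div x = (N - 1 - j) div x"
proof -
  define q where "q = N div x"
  define r where "r = N mod x"
  have N: "N = x * q + r" by (simp add: q_def r_def)
  have r: "r < x" using x by (simp add: r_def)
  have q: "1 \<le> q" using x by (simp add: q_def div_greater_zero_iff Suc_le_eq)
  then obtain q' where q': "q = Suc q'" by (cases q) auto
  show ?thesis
  proof (cases "Suc j < r")
    case True
    have "N - 1 - j = x * q + (r - 1 - j)" "N - 1 - Suc j = x * q + (r - 1 - Suc j)"
      using True N by linarith+
    moreover have "r - 1 - j < x" "r - 1 - Suc j < x" using r by linarith+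
    ultimately show ?thesis by simp
  next
    case False
    have "even r" using ev by (simp add: r_def)
    have "r \<noteq> Suc j"
    proof
      assume "r = Suc j"
      then show False using \<open>even r\<close> \<open>even j\<close> by simp
    qed
    then have "r \<le> j" using False by linarith
    have N': "N = x * q' + x + r" using N q' by simp
    have "N - 1 - j = x * q' + (x + r - 1 - j)" "N - 1 - Suc j = x * q' + (x + r - 1 - Suc j)"
      using j N' by linarith+
    moreover have "x + r - 1 - j < x" "x + r - 1 - Suc j < x" using \<open>r \<le> j\<close> x(1) by linarith+
    ultimately show ?thesis by simp
  qed
qed

text \<open>
  The residue classes modulo \<open>x\<close> are traversed upwards and downwards in turn. As \<open>N mod x\<close>
  is even, the two classes that meet at their top ends always have the same height.
\<close>

lemma tour_zigzag:
  assumes x: "0 < x" "x \<le> N" and ev: "even (N mod x)" and j: "Suc j \<le> x"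
  shows "\<exists>H. tour {z \<in> {0..<int N}. z mod int x < int (Suc j)} 0
    (if odd j then int j else int j + int x * int ((N - 1 - j) div x))
    (replicate_mset j 1 + replicate_mset H x)"
  using j
proof (induction j)
  case 0
  have "{z \<in> {0..<int N}. z mod int x < 1} = {z \<in> {0..<int N}. z mod int x = 0}"
    using x by (auto simp: order.antisym)
  then show ?case
    using tour_column[OF x(1) _ x(2), of 0] x by (intro exI[of _ "(N - 1) div x"]) simp
next
  case (Suc j)
  let ?h = "\<lambda>i. (N - 1 - i) div x"
  let ?C = "{z \<in> {0..<int N}. z mod int x = int (Suc j)}"
  let ?S = "{z \<in> {0..<int N}. z mod int x < int (Suc j)}"
  obtain H where H: "tour ?S 0 (if odd j then int j else int j + int x * int (?h j))
    (replicate_mset j 1 + replicate_mset H x)"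
    using Suc by auto
  have C: "tour ?C (int (Suc j)) (int (Suc j) + int x * int (?h (Suc j))) (replicate_mset (?h (Suc j)) x)"
    using tour_column[of x "Suc j" N] x Suc.prems by auto
  have disj: "?S \<inter> ?C = {}" by auto
  have un: "?S \<union> ?C = {z \<in> {0..<int N}. z mod int x < int (Suc (Suc j))}" by auto
  show ?case
  proof (cases "odd j")
    case True
    have "tour (?S \<union> ?C) 0 (int (Suc j) + int x * int (?h (Suc j)))
      (add_mset 1 (replicate_mset j 1 + replicate_mset H x + replicate_mset (?h (Suc j)) x))"
      using tour_append[OF H C disj] True by simp
    then show ?thesis unfolding un using True
      by (intro exI[of _ "H + ?h (Suc j)"]) (simp add: replicate_mset_plus add.assoc)
  next
    case False
    have same: "?h (Suc j) = ?h j"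
      using column_height_eq[OF x ev] False Suc.prems by auto
    have "tour (?S \<union> ?C) 0 (int (Suc j))
      (add_mset 1 (replicate_mset j 1 + replicate_mset H x + replicate_mset (?h (Suc j)) x))"
      using tour_append[OF H tour_rev[OF C] disj] False unfolding same by simp
    then show ?thesis unfolding un using False
      by (intro exI[of _ "H + ?h (Suc j)"]) (simp add: replicate_mset_plus add.assoc)
  qed
qed

text \<open>This is the full zigzag: \<open>x - 1\<close> unit steps join the \<open>x\<close>
  classes, and all other steps have length \<open>x\<close>.\<close>

lemma tour_two_lengths_even:
  assumes x: "0 < x" "x \<le> N" and ev: "even (N mod x)"
  shows "\<exists>w. tour {0..<int N} 0 w (replicate_mset (x - 1) 1 + replicate_mset (N - x) x)"
proof -
  have S: "{z \<in> {0..<int N}. z mod int x < int (Suc (x - 1))} = {0..<int N}"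
    using x by auto
  obtain H w where T: "tour {0..<int N} 0 w (replicate_mset (x - 1) 1 + replicate_mset H x)"
    using tour_zigzag[OF x ev, of "x - 1"] x unfolding S by auto
  have "H = N - x" using tour_card[OF T] x by simp
  with T show ?thesis by blast
qed

text \<open>Class 0 is set aside. The other classes form a shifted zigzag in an interval of
  \<open>N - 1\<close> points, whose residue is even. There are \<open>x - 1\<close> of them, an odd
  number, so the zigzag ends at a top, namely \<open>x q - 1\<close>. The next point
  \<open>x q\<close> is the top of class 0, which is then descended to \<open>0\<close>.\<close>

lemma tour_two_lengths_rotated:
  assumes x: "even x" "0 < x" "x < N" and od: "odd (N mod x)"
  shows "\<exists>w. tour {0..<int N} 0 w (replicate_mset (x - 1) 1 + replicate_mset (N - x) x)"
proof -
  define q where "q = N div x"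
  define r where "r = N mod x"
  have N: "N = x * q + r" by (simp add: q_def r_def)
  have r: "r < x" "odd r" using x od by (simp_all add: r_def)
  have q: "0 < q" using x by (simp add: q_def div_greater_zero_iff)
  have r1: "1 \<le> r" using r(2) by (simp add: Suc_le_eq odd_pos)
  have N1: "N - 1 = x * q + (r - 1)" using N r1 by simp
  have "(N - 1) mod x = r - 1" unfolding N1 mod_mult_self4 using r by simp
  then have ev: "even ((N - 1) mod x)" using r r1 by simp
  have xN: "x \<le> N - 1" using x by simp
  let ?S = "{z \<in> {0..<int (N - 1)}. z mod int x < int (Suc (x - 2))}"
  have x2: "2 \<le> x" using x(1,2) by (auto elim!: evenE)
  have top: "N - 1 - 1 - (x - 2) = x * (q - 1) + r" 
    using N1 r1 q x2 by (cases q) (auto simp: algebra_simps)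
  have div: "(N - 1 - 1 - (x - 2)) div x = q - 1" unfolding top using r by simp
  obtain H where H: "tour ?S 0 (int (x - 2) + int x * int (q - 1))
      (replicate_mset (x - 2) 1 + replicate_mset H x)"
  proof -
    have "even (x - 2)" "Suc (x - 2) \<le> x" using x(1) x2 by simp_all
    then show ?thesis using that tour_zigzag[OF x(2) xN ev, of "x - 2"] unfolding div by auto
  qed
  let ?C = "{z \<in> {0..<int N}. z mod int x = int 0}"
  have "(N - 1 - 0) div x = q" unfolding N1 using r by simp
  then have C: "tour ?C 0 (int x * int q) (replicate_mset q x)"
    using tour_column[of x 0 N] x by simp
  \<comment> \<open>Adding 1 carries the classes \<open>0\<close> to \<open>x - 2\<close> below
    \<open>N - 1\<close> onto the nonzero classes below \<open>N\<close>.\<close>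
  have img: "(\<lambda>z. z + 1) ` ?S = {z \<in> {0..<int N}. z mod int x \<noteq> 0}"
  proof (intro equalityI subsetI)
    fix y assume "y \<in> (\<lambda>z. z + 1) ` ?S"
    then obtain z where z: "y = z + 1" "0 \<le> z" "z < int (N - 1)" "z mod int x < int x - 1"
      using x2 by auto
    have "(z + 1) mod int x = z mod int x + 1"
      using z(4) x(2) by (simp add: mod_add_left_eq[of z "int x" 1, symmetric] mod_pos_pos_trivial)
    moreover have "0 \<le> z mod int x" using x(2) by simp
    ultimately have "(z + 1) mod int x \<noteq> 0" by linarith
    then show "y \<in> {z \<in> {0..<int N}. z mod int x \<noteq> 0}" using z x by simp
  next
    fix y assume y: "y \<in> {z \<in> {0..<int N}. z mod int x \<noteq> 0}"
    then have "y \<noteq> 0" by auto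
    have "0 < y mod int x" using y x(2) by (simp add: order.not_eq_order_implies_strict)
    moreover have "y mod int x < int x" using x(2) by simp
    moreover have "(y - 1) mod int x = (y mod int x - 1) mod int x" by (simp add: mod_diff_left_eq)
    ultimately have "(y - 1) mod int x = y mod int x - 1" by (simp add: mod_pos_pos_trivial)
    then have "y - 1 \<in> ?S" using y \<open>y \<noteq> 0\<close> x2 \<open>y mod int x < int x\<close> by auto
    then show "y \<in> (\<lambda>z. z + 1) ` ?S" by (intro image_eqI[of _ _ "y - 1"]) auto
  qed
  have H': "tour ((\<lambda>z. z + 1) ` ?S) 1 (int x * int q - 1) (replicate_mset (x - 2) 1 + replicate_mset H x)"
  proof -
    have eq: "int (x - 2) + int x * int (q - 1) + 1 = int x * int q - 1"
      using x2 q by (simp add: of_nat_diff algebra_simps)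
    have "tour ((\<lambda>z. z + 1) ` ?S) (0 + 1) (int (x - 2) + int x * int (q - 1) + 1)
        (replicate_mset (x - 2) 1 + replicate_mset H x)"
      by (rule tour_isometry[OF H]) simp
    then show ?thesis unfolding eq by simp
  qed
  have "tour ((\<lambda>z. z + 1) ` ?S \<union> ?C) 1 0
      (add_mset 1 (replicate_mset (x - 2) 1 + replicate_mset H x + replicate_mset q x))"
    using tour_append[OF H' tour_rev[OF C]] unfolding img by auto
  moreover have "(\<lambda>z. z + 1) ` ?S \<union> ?C = {0..<int N}" unfolding img by auto
  moreover have "add_mset 1 (replicate_mset (x - 2) 1 + replicate_mset H x + replicate_mset q x)
      = replicate_mset (x - 1) 1 + replicate_mset (H + q) x"
  proof -
    have "x - 1 = Suc (x - 2)" using x2 by simp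
    then show ?thesis by (simp add: replicate_mset_plus add.assoc)
  qed
  ultimately have T: "tour {0..<int N} 1 0 (replicate_mset (x - 1) 1 + replicate_mset (H + q) x)"
    by simp
  have "H + q = N - x" using tour_card[OF T] x by simp
  then show ?thesis using tour_rev[OF T] by auto
qed

text \<open>Each round goes \<open>a\<close>, \<open>a + d\<close>, \<open>a + 1 + d\<close>,
  \<open>a + 1\<close>. With the unit step into \<open>a\<close> it costs two edges of length 1 and
  two rungs, and it ends just before the next \<open>a\<close>. The bound
  \<open>2 s \<le> |d|\<close> keeps the two sides apart; \<open>d\<close> may be negative.\<close>

lemma tour_ladder_extend:
  assumes "tour S u (e - 1) M" and "2 * int s \<le> \<bar>d\<bar>"
    and "S \<inter> ({e..<e + 2 * int s} \<union> {e + d..<e + d + 2 * int s}) = {}"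
  shows "tour (S \<union> ({e..<e + 2 * int s} \<union> {e + d..<e + d + 2 * int s})) u (e + 2 * int s - 1)
    (M + replicate_mset (2 * s) 1 + replicate_mset (2 * s) (nat \<bar>d\<bar>))"
  using assms(2,3)
proof (induction s)
  case 0
  then show ?case using assms(1) by simp
next
  case (Suc s)
  let ?L = "\<lambda>s. {e..<e + 2 * int s} \<union> {e + d..<e + d + 2 * int s}"
  let ?a = "e + 2 * int s"
  have IH: "tour (S \<union> ?L s) u (?a - 1) (M + replicate_mset (2 * s) 1 + replicate_mset (2 * s) (nat \<bar>d\<bar>))"
    using Suc.prems by (intro Suc.IH) auto
  have d: "d \<noteq> 0" "d \<noteq> 1" "d \<noteq> -1" using Suc.prems(1) by auto
  have "tour {?a + 1} (?a + 1) (?a + 1) {#}" by (rule tour.single)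
  from tour.step[OF this, of "?a + 1 + d"]
  have "tour {?a + 1 + d, ?a + 1} (?a + 1 + d) (?a + 1) {#nat \<bar>d\<bar>#}" using d by simp
  from tour.step[OF this, of "?a + d"]
  have "tour {?a + d, ?a + 1 + d, ?a + 1} (?a + d) (?a + 1) {#1, nat \<bar>d\<bar>#}" using d by simp
  from tour.step[OF this, of ?a]
  have R: "tour {?a, ?a + d, ?a + 1 + d, ?a + 1} ?a (?a + 1) {#nat \<bar>d\<bar>, 1, nat \<bar>d\<bar>#}"
    using d by simp
  have eq: "?L (Suc s) = ?L s \<union> {?a, ?a + d, ?a + 1 + d, ?a + 1}" by auto
  have disj: "(S \<union> ?L s) \<inter> {?a, ?a + d, ?a + 1 + d, ?a + 1} = {}"
    using Suc.prems unfolding eq by auto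
  have un: "S \<union> ?L s \<union> {?a, ?a + d, ?a + 1 + d, ?a + 1} = S \<union> ?L (Suc s)"
    unfolding eq by blast
  show ?case using tour_append[OF IH R disj] unfolding un
    by (simp add: algebra_simps add_mset_commute)
qed

text \<open>The mirror image is built: jump from \<open>0\<close> to \<open>- x\<close>, climb by
  unit steps to \<open>- 2 s - 1\<close>, then run a ladder whose rungs lead down by
  \<open>x\<close>. The jump is the odd edge of length \<open>x\<close>.\<close>

lemma tour_two_lengths_short:
  assumes "2 * s + 1 < x"
  shows "\<exists>w. tour {0..<int (2 * s + 1 + x)} 0 w (replicate_mset (x - 1) 1 + replicate_mset (2 * s + 1) x)"
proof -
  define n where "n = x - (2 * s + 1)"
  have x: "int x = 2 * int s + 1 + int n" using assms by (simp add: n_def)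
  let ?I = "{- int x..<- int x + int (Suc n)}"
  let ?S = "insert 0 ?I"
  have S: "tour ?S 0 (- 2 * int s - 1) (add_mset x (replicate_mset n 1))"
  proof -
    have "nat \<bar>0 - - int x\<bar> = x" "- int x + int n = - 2 * int s - 1" "0 \<notin> ?I" using x by auto
    then show ?thesis using tour.step[OF tour_interval[of "- int x" n], of 0] by simp
  qed
  have "tour (?S \<union> ({- 2 * int s..<- 2 * int s + 2 * int s} \<union>
      {- 2 * int s + - int x..<- 2 * int s + - int x + 2 * int s})) 0 (- 2 * int s + 2 * int s - 1)
    (add_mset x (replicate_mset n 1) + replicate_mset (2 * s) 1 + replicate_mset (2 * s) (nat \<bar>- int x\<bar>))"
    by (rule tour_ladder_extend) (use S assms x in auto)
  moreover have "?S \<union> ({- 2 * int s..<- 2 * int s + 2 * int s} \<union>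
      {- 2 * int s + - int x..<- 2 * int s + - int x + 2 * int s}) = uminus ` {0..<int (2 * s + 1 + x)}"
  proof -
    have "uminus ` {0..<int (2 * s + 1 + x)} = {- 2 * int s - int x..0}"
    proof (intro equalityI subsetI)
      fix y assume "y \<in> {- 2 * int s - int x..0}"
      then show "y \<in> uminus ` {0..<int (2 * s + 1 + x)}" by (intro image_eqI[of _ _ "- y"]) auto
    qed auto
    also have "\<dots> = ?S \<union> ({- 2 * int s..<- 2 * int s + 2 * int s} \<union>
      {- 2 * int s + - int x..<- 2 * int s + - int x + 2 * int s})" using x by auto
    finally show ?thesis by simp
  qed
  moreover have "add_mset x (replicate_mset n 1) + replicate_mset (2 * s) 1 + replicate_mset (2 * s) (nat \<bar>- int x\<bar>)
      = replicate_mset (x - 1) 1 + replicate_mset (2 * s + 1) x"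
  proof -
    have "x - 1 = n + 2 * s" using assms by (simp add: n_def)
    then show ?thesis by (simp add: replicate_mset_plus)
  qed
  ultimately have "tour (uminus ` {0..<int (2 * s + 1 + x)}) 0 (- 1)
      (replicate_mset (x - 1) 1 + replicate_mset (2 * s + 1) x)" by simp
  from tour_isometry[OF this, of uminus]
  have "tour (uminus ` uminus ` {0..<int (2 * s + 1 + x)}) 0 1
      (replicate_mset (x - 1) 1 + replicate_mset (2 * s + 1) x)"
    by (simp only: minus_zero minus_minus)
  then show ?thesis unfolding image_image minus_minus image_ident by blast
qed

text \<open>
  Here the zigzag would use one edge of length \<open>x\<close> too many. Its last two classes are
  traversed so that the top of class \<open>x - 2\<close> comes first and the rest of it last, which
  trades one edge of length \<open>x\<close> for an edge of length 1.
\<close>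

lemma tour_two_lengths_split:
  assumes x: "odd x" "3 \<le> x" and N: "2 * x \<le> N" and ev: "even (N mod x)"
  shows "\<exists>w. tour {0..<int N} 0 w (replicate_mset x 1 + replicate_mset (N - x - 1) x)"
proof -
  define q where "q = N div x"
  define r where "r = N mod x"
  have Nqr: "N = x * q + r" by (simp add: q_def r_def)
  have r: "r < x" "even r" using x ev by (simp_all add: r_def)
  have q: "2 \<le> q" using div_le_mono[OF N, of x] x by (simp add: q_def)
  have x0: "0 < x" "x \<le> N" using x N by auto
  \<comment> \<open>Class \<open>x - 2\<close> contains \<open>x q - 2\<close>, called
    \<open>?m\<close> below, and one further point above it exactly when \<open>r = x - 1\<close>.
    So \<open>n\<close> is the number of steps in the detached top piece \<open>?A\<close>.\<close>
  define n where "n = (if r = x - 1 then 1 else 0 :: nat)"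
  \<comment> \<open>Parity excludes the one residue for which classes \<open>x - 3\<close> and
    \<open>x - 2\<close> would have different heights.\<close>
  have rn: "r \<noteq> x - 2" using r x by (auto simp: even_diff_nat)
  let ?S = "{z \<in> {0..<int N}. z mod int x < int (Suc (x - 3))}"
  let ?m = "int x * int q - 2"
  let ?A = "{z \<in> {?m..<int N}. z mod int x = int x - 2}"
  let ?B = "{z \<in> {int x - 1..<int N}. z mod int x = int x - 1}"
  let ?C = "{z \<in> {int x - 2..<?m}. z mod int x = int x - 2}"
  have intN: "int N = int x * int q + int r" using Nqr by simp
  have qq: "int (q - 1) = int q - 1" "int (q - 2) = int q - 2" using q by auto
  have residues: "(int x - 1) mod int x = int x - 1" "(int x - 2) mod int x = int x - 2"
    using x by (intro mod_pos_pos_trivial; simp)+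
  have A: "tour ?A ?m (?m + int x * int n) (replicate_mset n x)"
  proof (rule tour_class)
    have "?m = (int x - 2) + int x * (int q - 1)" by (simp add: algebra_simps)
    also have "\<dots> mod int x = int x - 2" unfolding mod_mult_self2 by (rule residues)
    finally show "?m mod int x = int x - 2" .
  qed (use r rn x intN in \<open>auto simp: n_def of_nat_diff split: if_splits\<close>)
  have B: "tour ?B (int x - 1) (int x * int q - 1) (replicate_mset (q - 1) x)"
  proof -
    have eq: "int x - 1 + int x * int (q - 1) = int x * int q - 1"
      unfolding qq by (simp add: algebra_simps)
    have "tour ?B (int x - 1) (int x - 1 + int x * int (q - 1)) (replicate_mset (q - 1) x)"
      by (rule tour_class) (use eq r x intN residues in auto)
    then show ?thesis unfolding eq .
  qed
  have C: "tour ?C (int x - 2) (?m - int x) (replicate_mset (q - 2) x)"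
  proof -
    have eq: "int x - 2 + int x * int (q - 2) = ?m - int x"
      unfolding qq by (simp add: algebra_simps)
    have "tour ?C (int x - 2) (int x - 2 + int x * int (q - 2)) (replicate_mset (q - 2) x)"
      by (rule tour_class) (use eq r x intN residues in auto)
    then show ?thesis unfolding eq .
  qed
  have top: "int (x - 3) + int x * int ((N - 1 - (x - 3)) div x) = ?m + int x * int n - 1"
  proof -
    obtain q' where q': "q = Suc q'" using q by (cases q) auto
    have "(N - 1 - (x - 3)) div x = q - 1 + n"
    proof (cases "r = x - 1")
      case True
      have "N - 1 - (x - 3) = x * q + 1" using True Nqr x by (simp add: q')
      also have "\<dots> div x = q" using x by (subst div_mult_self4) auto
      finally show ?thesis using True q by (simp add: n_def)
    next
      case False
      then have "r + 2 < x" using r rn by linarith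
      moreover have "N - 1 - (x - 3) = x * (q - 1) + (r + 2)" using Nqr x by (simp add: q')
      ultimately have "(N - 1 - (x - 3)) div x = q - 1"
        using x by (simp only: div_mult_self4 div_less)
      then show ?thesis using False by (simp add: n_def)
    qed
    then show ?thesis using x q by (simp add: of_nat_diff algebra_simps)
  qed
  obtain H where H: "tour ?S 0 (?m + int x * int n - 1) (replicate_mset (x - 3) 1 + replicate_mset H x)"
  proof -
    have "even (x - 3)" "Suc (x - 3) \<le> x" using x by simp_all
    then show ?thesis using that tour_zigzag[OF x0 ev, of "x - 3"] unfolding top by auto
  qed
  have disjoint: "?B \<inter> ?C = {}" "?A \<inter> (?B \<union> ?C) = {}" by auto
  \<comment> \<open>Class \<open>x - 1\<close> is entered at its top \<open>x q - 1\<close>, next to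
    \<open>?m\<close>, and left at its bottom \<open>x - 1\<close>, next to the start of
    \<open>?C\<close>. The step of length \<open>x\<close> from \<open>?m - x\<close> to
    \<open>?m\<close> is the one saved.\<close>
  have CB: "tour (?B \<union> ?C) (int x * int q - 1) (?m - int x)
      (add_mset 1 (replicate_mset (q - 1) x + replicate_mset (q - 2) x))"
    using tour_append[OF tour_rev[OF B] C disjoint(1)] by simp
  have ABC: "tour (?A \<union> (?B \<union> ?C)) (?m + int x * int n) (?m - int x)
      (add_mset 1 (replicate_mset n x + add_mset 1 (replicate_mset (q - 1) x + replicate_mset (q - 2) x)))"
    using tour_append[OF tour_rev[OF A] CB disjoint(2)] by simp
  have disj: "?S \<inter> (?A \<union> (?B \<union> ?C)) = {}" using x by auto
  have un: "?S \<union> (?A \<union> (?B \<union> ?C)) = {0..<int N}"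
  proof (intro equalityI subsetI)
    fix z assume "z \<in> ?S \<union> (?A \<union> (?B \<union> ?C))"
    moreover have "0 \<le> ?m"
      using mult_mono[of 2 "int x" 1 "int q"] x q by simp
    ultimately show "z \<in> {0..<int N}" using x intN by auto
  next
    fix z assume z: "z \<in> {0..<int N}"
    have le: "z mod int x \<le> z" using z by (simp add: zmod_le_nonneg_dividend)
    have "z mod int x < int x" using x by simp
    then consider "z mod int x < int x - 2" | "z mod int x = int x - 2" | "z mod int x = int x - 1"
      by linarith
    then show "z \<in> ?S \<union> (?A \<union> (?B \<union> ?C))"
      using z le x by cases (auto simp: of_nat_diff)
  qed
  have T: "tour {0..<int N} 0 (?m - int x) (replicate_mset x 1 + replicate_mset (H + n + (q - 1) + (q - 2)) x)"
  proof -
    have "x = Suc (Suc (Suc (x - 3)))" using x by simp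
    then have "replicate_mset x (1::nat) = {#1, 1, 1#} + replicate_mset (x - 3) 1"
      by (metis add_mset_add_single replicate_mset_Suc union_mset_add_mset_left add_0)
    then show ?thesis
      using tour_append[OF H ABC disj] unfolding un by (simp add: replicate_mset_plus add.assoc)
  qed
  have "H + n + (q - 1) + (q - 2) = N - x - 1" using tour_card[OF T] x by simp
  with T show ?thesis by metis
qed

text \<open>It suffices to use some \<open>a0 \<le> x\<close> unit steps and to put the rest in
  front. With \<open>a0 = x - 1\<close> the interval has \<open>x + b\<close> points and residue
  \<open>b mod x\<close>, so the parities of \<open>b mod x\<close> and \<open>x\<close> select the
  construction. Only for odd \<open>x\<close>, odd \<open>b mod x\<close> and
  \<open>b \<ge> x\<close> is \<open>a0 = x\<close> used.\<close>

lemma tour_two_lengths: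
  assumes x: "0 < x" and a: "x \<le> a"
  shows "\<exists>w. tour {0..<int (a + b + 1)} 0 w (replicate_mset a 1 + replicate_mset b x)"
proof -
  have "\<exists>a0 \<le> x. \<exists>w. tour {0..<int (a0 + b + 1)} 0 w (replicate_mset a0 1 + replicate_mset b x)"
  proof (cases "even (b mod x)")
    case True
    then show ?thesis
      using tour_two_lengths_even[of x "x + b"] x by (intro exI[of _ "x - 1"]) simp
  next
    case False
    then have b: "b > 0" using x by (cases b) auto
    show ?thesis
    proof (cases "even x")
      case True
      then show ?thesis
        using tour_two_lengths_rotated[of x "x + b"] x b \<open>odd (b mod x)\<close>
        by (intro exI[of _ "x - 1"]) simp
    next
      case odd: False
      show ?thesis
      proof (cases "b < x")
        case True
        then obtain s where "b = 2 * s + 1" using \<open>odd (b mod x)\<close> by (auto elim!: oddE)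
        then show ?thesis
          using tour_two_lengths_short[of s x] True by (intro exI[of _ "x - 1"]) (simp add: ac_simps)
      next
        case False
        have "x \<noteq> 1" using \<open>odd (b mod x)\<close> by auto
        then have "3 \<le> x" using odd x by (cases x rule: nat.exhaust) (auto elim!: oddE)
        moreover have "even ((x + b + 1) mod x)"
        proof -
          have "(x + b + 1) mod x = Suc b mod x" by (metis Suc_eq_plus1 add.assoc mod_add_self1)
          then show ?thesis using \<open>odd (b mod x)\<close> mod_Suc[of b x] by simp
        qed
        ultimately show ?thesis
          using tour_two_lengths_split[of x "x + b + 1"] odd False by (intro exI[of _ x]) simp
      qed
    qed
  qed
  then obtain a0 w where "a0 \<le> x"
    and "tour {0..<int (a0 + b + 1)} 0 w (replicate_mset a0 1 + replicate_mset b x)" by blast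
  from tour_prepend_ones[OF this(2), of "a - a0"] \<open>a0 \<le> x\<close> a show ?thesis
    by (metis (no_types, lifting) add.assoc add.commute le_add_diff_inverse le_trans replicate_mset_plus)
qed

section \<open>Three edge lengths, one of them 1\<close>

text \<open>A tour with lengths 1 and \<open>x\<close>, reflected so as to end at its top, is
  followed by one with lengths 1 and \<open>y\<close> on the adjacent interval. The two use
  \<open>x\<close> and at least \<open>y\<close> unit steps, and one more joins them.\<close>

lemma tour_three_lengths:
  assumes "0 < x" "0 < y" "x + y + 1 \<le> a"
  shows "\<exists>u w. tour {0..<int (a + b + c + 1)} u w
    (replicate_mset a 1 + replicate_mset b x + replicate_mset c y)"
proof -
  define n where "n = x + b + 1"
  define a' where "a' = a - x - 1"
  obtain p where "tour {0..<int n} 0 p (replicate_mset x 1 + replicate_mset b x)"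
    using tour_two_lengths[of x x b] assms(1) unfolding n_def by auto
  from tour_rev[OF tour_reflect[OF this]]
  have P: "tour {0..<int n} (int n - 1 - p) (int n - 1) (replicate_mset x 1 + replicate_mset b x)"
    by simp
  obtain p' where "tour {0..<int (a' + c + 1)} 0 p' (replicate_mset a' 1 + replicate_mset c y)"
    using tour_two_lengths[of y a' c] assms unfolding a'_def by fastforce
  from tour_translate[OF this, of "int n"]
  have P': "tour {int n..<int (a' + c + 1) + int n} (int n) (p' + int n) (replicate_mset a' 1 + replicate_mset c y)"
    by simp
  have un: "{0..<int n} \<union> {int n..<int (a' + c + 1) + int n} = {0..<int (a + b + c + 1)}"
    using assms(3) by (auto simp: n_def a'_def)
  have "a = Suc (x + a')" using assms(3) by (simp add: a'_def)
  then have M: "add_mset 1 (replicate_mset x 1 + replicate_mset b x + (replicate_mset a' 1 + replicate_mset c y))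
      = replicate_mset a 1 + replicate_mset b x + replicate_mset c y"
    by (simp add: replicate_mset_plus)
  have "tour {0..<int (a + b + c + 1)} (int n - 1 - p) (p' + int n)
      (replicate_mset a 1 + replicate_mset b x + replicate_mset c y)"
    using tour_append[OF P P'] unfolding un M[symmetric] by simp
  then show ?thesis by blast
qed

section \<open>Few edges of length \<open>y\<close>\<close>

text \<open>Every second point is visited on the way up and the others on the way down, so the tour
  ends beside its start. The only unit step is at the turn.\<close>

lemma tour_up_down:
  "tour {e..<e + 2 * int n + 2} e (e + 1) (add_mset 1 (replicate_mset (2 * n) 2))"
proof (induction n arbitrary: e)
  case 0
  have "{e..<e + 2} = insert e {e + 1}" by auto
  then show ?case using tour.step[OF tour.single, of e "e + 1"] by simp
next
  case (Suc n)
  have I: "tour {e + 2..<e + 2 + 2 * int n + 2} (e + 2) (e + 3) (add_mset 1 (replicate_mset (2 * n) 2))"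
    using Suc[of "e + 2"] by (simp add: algebra_simps)
  have "tour ({e + 2..<e + 2 + 2 * int n + 2} \<union> {e + 1}) (e + 2) (e + 1)
      (add_mset 2 (add_mset 1 (replicate_mset (2 * n) 2)))"
    using tour_append[OF I tour.single[of "e + 1"]] by simp
  from tour.step[OF this, of e]
  have "tour (insert e ({e + 2..<e + 2 + 2 * int n + 2} \<union> {e + 1})) e (e + 1)
      (add_mset 2 (add_mset 2 (add_mset 1 (replicate_mset (2 * n) 2))))" by simp
  moreover have "insert e ({e + 2..<e + 2 + 2 * int n + 2} \<union> {e + 1}) = {e..<e + 2 * int (Suc n) + 2}"
    by auto
  ultimately show ?case by (simp add: add_mset_commute)
qed

text \<open>
  The tour consists of an initial block, a ladder of rungs of length \<open>y\<close> that follows it,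
  and the block between the two sides of the ladder. For odd \<open>a\<close> the remaining edge of
  length \<open>y\<close> comes last.
\<close>

lemma tour_ladder:
  assumes "even y" "a + 2 \<le> y" "a + 4 \<le> b" "y \<le> c"
  shows "\<exists>u w. tour {0..<int (b + c + a + 1)} u w
    (replicate_mset b 1 + replicate_mset c 2 + replicate_mset a y)"
proof -
  define s where "s = a div 2"
  obtain h where h: "y = 2 * h" using assms(1) by blast
  \<comment> \<open>The gap between the two sides of the ladder has \<open>y - 2 s = 2 n + 2\<close>
    points, the size needed for \<open>tour_up_down\<close>.\<close>
  define n where "n = h - s - 1"
  have y: "int y = 2 * int s + 2 * int n + 2" using assms(2) by (simp add: h n_def s_def)
  \<comment> \<open>\<open>\<alpha>\<close> and \<open>\<beta>\<close> are what remains of lengths 1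
    and 2 for the initial block. For even \<open>a\<close> the middle block is entered by a unit
    step, for odd \<open>a\<close> by a step of length 2.\<close>
  define \<alpha> where "\<alpha> = (if even a then b - 2 * s - 2 else b - 2 * s - 1)"
  define \<beta> where "\<beta> = (if even a then c - 2 * n else c - 2 * n - 1)"
  define m where "m = \<alpha> + \<beta> + 1"
  have a: "a = (if even a then 2 * s else 2 * s + 1)" by (simp add: s_def)
  have \<alpha>: "2 \<le> \<alpha>" "b = (if even a then \<alpha> + 2 * s + 2 else \<alpha> + 2 * s + 1)"
    using assms(3) a by (auto simp: \<alpha>_def split: if_splits)
  have \<beta>: "c = (if even a then \<beta> + 2 * n else \<beta> + 2 * n + 1)"
    using assms(4) y by (auto simp: \<beta>_def)
  obtain p where "tour {0..<int m} 0 p (replicate_mset \<alpha> 1 + replicate_mset \<beta> 2)"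
    using tour_two_lengths[of 2 \<alpha> \<beta>] \<alpha>(1) unfolding m_def by auto
  from tour_rev[OF tour_reflect[OF this]]
  have P: "tour {0..<int m} (int m - 1 - p) (int m - 1) (replicate_mset \<alpha> 1 + replicate_mset \<beta> 2)"
    by simp
  let ?M = "replicate_mset \<alpha> 1 + replicate_mset \<beta> 2 + replicate_mset (2 * s) 1 + replicate_mset (2 * s) y"
  let ?e = "int m + 2 * int s"
  let ?L = "{0..<int m} \<union> ({int m..<?e} \<union> {int m + int y..<int m + int y + 2 * int s})"
  let ?U = "{?e..<?e + 2 * int n + 2}"
  have L: "tour ?L (int m - 1 - p) (?e - 1) ?M"
  proof -
    have "2 * int s \<le> \<bar>int y\<bar>" using y by simp
    moreover have "{0..<int m} \<inter> ({int m..<?e} \<union> {int m + int y..<int m + int y + 2 * int s}) = {}"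
      by auto
    ultimately show ?thesis using tour_ladder_extend[OF P, of s "int y"] by simp
  qed
  have U: "tour ?U ?e (?e + 1) (add_mset 1 (replicate_mset (2 * n) 2))" by (rule tour_up_down)
  have disj: "?L \<inter> ?U = {}" using y by auto
  have un: "?L \<union> ?U = {0..<int (m + y + 2 * s)}" using y by auto
  show ?thesis
  proof (cases "even a")
    case True
    have "tour {0..<int (m + y + 2 * s)} (int m - 1 - p) (?e + 1)
        (add_mset 1 (?M + add_mset 1 (replicate_mset (2 * n) 2)))"
      using tour_append[OF L U disj] unfolding un by simp
    moreover have "add_mset 1 (?M + add_mset 1 (replicate_mset (2 * n) 2))
        = replicate_mset b 1 + replicate_mset c 2 + replicate_mset a y"
      using True a \<alpha>(2) \<beta> by (simp add: replicate_mset_plus)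
    moreover have "m + y + 2 * s = b + c + a + 1"
      using True a \<alpha>(2) \<beta> y unfolding m_def by simp
    ultimately show ?thesis by auto
  next
    case False
    \<comment> \<open>The middle block is traversed backwards, to finish at \<open>?e\<close>: then
      \<open>?e + y\<close> is the first point beyond the interval covered so far.\<close>
    have T: "tour {0..<int (m + y + 2 * s)} (int m - 1 - p) ?e
        (add_mset 2 (?M + add_mset 1 (replicate_mset (2 * n) 2)))"
      using tour_append[OF L tour_rev[OF U] disj] unfolding un by simp
    have "tour ({0..<int (m + y + 2 * s)} \<union> {?e + int y}) (int m - 1 - p) (?e + int y)
        (add_mset y (add_mset 2 (?M + add_mset 1 (replicate_mset (2 * n) 2))))"
      using tour_append[OF T tour.single[of "?e + int y"]] by simp
    moreover have "add_mset y (add_mset 2 (?M + add_mset 1 (replicate_mset (2 * n) 2)))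
        = replicate_mset b 1 + replicate_mset c 2 + replicate_mset a y"
      using False a \<alpha>(2) \<beta> by (simp add: replicate_mset_plus)
    moreover have "{0..<int (m + y + 2 * s)} \<union> {?e + int y} = {0..<int (b + c + a + 1)}"
    proof -
      have "int (b + c + a + 1) = ?e + int y + 1"
        using False a \<alpha>(2) \<beta> y unfolding m_def by simp
      then show ?thesis by auto
    qed
    ultimately show ?thesis by auto
  qed
qed

section \<open>From tours to Hamiltonian paths\<close>

lemma tour_imp_path:
  assumes "tour S u w M" and "inj_on f S"
    and "\<And>z z'. z \<in> S \<Longrightarrow> z' \<in> S \<Longrightarrow> nat \<bar>z - z'\<bar> \<in># M \<Longrightarrow> edge_length v (f z) (f z') = \<phi> (nat \<bar>z - z'\<bar>)"
  shows "\<exists>p. p \<noteq> [] \<and> hd p = f u \<and> distinct p \<and> set p = f ` S \<and> path_lengths v p = image_mset \<phi> M"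
  using assms
proof (induction rule: tour.induct)
  case (single u)
  show ?case by (rule exI[of _ "[f u]"]) (simp add: path_lengths_def)
next
  case (step S u w M z)
  have "\<exists>p. p \<noteq> [] \<and> hd p = f u \<and> distinct p \<and> set p = f ` S \<and> path_lengths v p = image_mset \<phi> M"
    using step.prems by (intro step.IH) auto
  then obtain p where p: "p \<noteq> []" "hd p = f u" "distinct p" "set p = f ` S"
    "path_lengths v p = image_mset \<phi> M" by blast
  have "path_lengths v (f z # p) = add_mset (edge_length v (f z) (f u)) (path_lengths v p)"
    using p(1,2) by (cases p) (simp_all add: path_lengths_def)
  moreover have "edge_length v (f z) (f u) = \<phi> (nat \<bar>z - u\<bar>)"
    using step.prems(2) tour_memb[OF step.hyps(1)] by simp
  moreover have "f z \<notin> f ` S" using step by (auto simp: inj_on_def)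
  ultimately show ?case using p by (intro exI[of _ "f z # p"]) simp
qed

lemma hamiltonian_path_complete_graph:
  assumes "p \<noteq> []" "distinct p" "set p = {0..<v}"
  shows "hamiltonian_path p (with_proj (complete_graph v))"
proof -
  have "set (vwalk_arcs q) \<subseteq> {(u, w). u \<in> set q \<and> w \<in> set q \<and> u \<noteq> w}" if "distinct q" for q :: "nat list"
    using that by (induction q rule: vwalk_arcs.induct) auto
  from this[OF assms(2)] assms show ?thesis
    by (auto simp: hamiltonian_path_def vpath_def vwalk_def complete_graph_def arcs_ends_def
        arc_to_ends_def image_iff)
qed

text \<open>The two residues differ by less than \<open>v\<close> and their difference is congruent
  to \<open>e\<close> or \<open>- e\<close>. As \<open>2 e < v\<close>, it is one of these or is
  shifted from it by \<open>v\<close>, and each possibility has cyclic length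
  \<open>e\<close>.\<close>

lemma edge_length_scaled:
  fixes g z z' :: int
  assumes "[g * \<bar>z - z'\<bar> = int e] (mod int v) \<or> [g * \<bar>z - z'\<bar> = - int e] (mod int v)"
    and "0 < e" "2 * e < v"
  shows "edge_length v (nat ((g * z) mod int v)) (nat ((g * z') mod int v)) = e"
proof -
  define A B where "A = (g * z) mod int v" and "B = (g * z') mod int v"
  have v: "0 < int v" using assms by simp
  have AB: "0 \<le> A" "A < int v" "0 \<le> B" "B < int v" using v by (simp_all add: A_def B_def)
  have c: "[A - B = g * (z - z')] (mod int v)"
    by (simp add: A_def B_def cong_def mod_diff_eq right_diff_distrib)
  have "[A - B = int e] (mod int v) \<or> [A - B = - int e] (mod int v)"
  proof (cases "z \<le> z'")
    case False
    then show ?thesis using assms(1) c cong_trans by (metis abs_of_pos diff_gt_0_iff_gt not_le)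
  next
    case True
    then have "g * \<bar>z - z'\<bar> = - (g * (z - z'))" by (simp add: algebra_simps)
    then have "[g * (z - z') = - int e] (mod int v) \<or> [g * (z - z') = int e] (mod int v)"
      using assms(1) by (metis cong_minus_minus_iff minus_minus)
    then show ?thesis using c cong_trans by blast
  qed
  then obtain s where s: "s = int e \<or> s = - int e" "int v dvd A - B - s"
    unfolding cong_iff_dvd_diff by blast
  then obtain k where k: "A - B - s = int v * k" by blast
  have sb: "2 * s < int v" "- int v < 2 * s" using s(1) assms by auto
  have "int v * k < int v * 2" "int v * (- 2) < int v * k" using k AB sb by linarith+
  then have "k < 2" "- 2 < k" using v by (simp_all only: mult_less_cancel_left_pos)
  then consider "k = -1" | "k = 0" | "k = 1" by linarith
  then have "min (\<bar>A - B\<bar>) (int v - \<bar>A - B\<bar>) = int e"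
    using s(1) k AB sb assms(2,3) by cases auto
  moreover have "int (edge_length v (nat A) (nat B)) = min (\<bar>A - B\<bar>) (int v - \<bar>A - B\<bar>)"
  proof -
    define D where "D = nat \<bar>A - B\<bar>"
    have D: "int D = \<bar>A - B\<bar>" "D \<le> v" using AB by (simp_all add: D_def nat_le_iff abs_le_iff)
    have "edge_length v (nat A) (nat B) = min D (v - D)"
      using AB by (simp add: edge_length_def D_def)
    then show ?thesis using D by (simp add: of_nat_min of_nat_diff)
  qed
  ultimately have "edge_length v (nat A) (nat B) = e" by simp
  then show ?thesis by (simp add: A_def B_def)
qed

text \<open>Multiplication by the unit \<open>g\<close> permutes the residues modulo
  \<open>v\<close>, so it turns the tour into a Hamiltonian path, and \<open>\<phi>\<close> tells
  what becomes of each length.\<close>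

lemma tour_imp_realizable:
  assumes T: "tour {0..<int v} u w M" and g: "coprime g (int v)"
    and \<phi>: "\<And>d. d \<in># M \<Longrightarrow> 0 < \<phi> d \<and> 2 * \<phi> d < v \<and>
      ([g * int d = int (\<phi> d)] (mod int v) \<or> [g * int d = - int (\<phi> d)] (mod int v))"
  shows "realizable v (image_mset \<phi> M)"
proof -
  let ?f = "\<lambda>z. nat ((g * z) mod int v)"
  have v: "0 < int v" using tour_memb[OF T] by auto
  have inj: "inj_on ?f {0..<int v}"
  proof (rule inj_onI)
    fix z z' assume z: "z \<in> {0..<int v}" "z' \<in> {0..<int v}" and "?f z = ?f z'"
    then have "[g * z = g * z'] (mod int v)" using v by (simp add: cong_def eq_nat_nat_iff)
    then have "[z = z'] (mod int v)" using g by (simp add: cong_mult_lcancel)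
    then show "z = z'" using z by (simp add: cong_def mod_pos_pos_trivial)
  qed
  have "?f ` {0..<int v} \<subseteq> {0..<v}" using v by (auto simp: nat_less_iff)
  moreover have "card (?f ` {0..<int v}) = card {0..<v}" using card_image[OF inj] by simp
  ultimately have img: "?f ` {0..<int v} = {0..<v}" by (simp add: card_subset_eq)
  have len: "edge_length v (?f z) (?f z') = \<phi> (nat \<bar>z - z'\<bar>)" if "nat \<bar>z - z'\<bar> \<in># M" for z z'
    using \<phi>[OF that] by (intro edge_length_scaled) auto
  obtain p where "p \<noteq> []" "distinct p" "set p = {0..<v}" "path_lengths v p = image_mset \<phi> M"
    using tour_imp_path[OF T inj, of v \<phi>] len unfolding img by blast
  then show ?thesis unfolding realizable_def
    using hamiltonian_path_complete_graph by blast
qed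

lemma tour_three_imp_realizable:
  assumes T: "tour {0..<int v} u w (replicate_mset a 1 + replicate_mset b x + replicate_mset c y)"
    and g: "coprime g (int v)" and dist: "1 \<noteq> x" "1 \<noteq> y" "x \<noteq> y"
    and p: "0 < p" "2 * p < v" "[g = int p] (mod int v) \<or> [g = - int p] (mod int v)"
    and q: "0 < q" "2 * q < v" "[g * int x = int q] (mod int v) \<or> [g * int x = - int q] (mod int v)"
    and r: "0 < r" "2 * r < v" "[g * int y = int r] (mod int v) \<or> [g * int y = - int r] (mod int v)"
  shows "realizable v (replicate_mset a p + replicate_mset b q + replicate_mset c r)"
proof -
  let ?\<phi> = "\<lambda>d. if d = 1 then p else if d = x then q else r"
  have "realizable v (image_mset ?\<phi> (replicate_mset a 1 + replicate_mset b x + replicate_mset c y))"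
    using T g
  proof (rule tour_imp_realizable)
    fix d assume "d \<in># replicate_mset a 1 + replicate_mset b x + replicate_mset c y"
    then consider "d = 1" | "d = x" | "d = y" by (auto split: if_splits)
    then show "0 < ?\<phi> d \<and> 2 * ?\<phi> d < v \<and>
      ([g * int d = int (?\<phi> d)] (mod int v) \<or> [g * int d = - int (?\<phi> d)] (mod int v))"
      using dist p q r by cases auto
  qed
  then show ?thesis using dist by simp
qed


section \<open>Multiplicity thresholds and the choice of multiplier\<close>

text \<open>If all three fail, adding the bounds gives \<open>(t - 2) * (k - 2) \<le> 6\<close>,
  which is too small for \<open>v > 6 t + 53\<close>.\<close>

lemma threshold_arith:
  fixes t k :: nat
  assumes t: "3 \<le> t" and v: "v = 3 * t * k + 1 \<or> v + 1 = 3 * t * k" "6 * t + 53 < v"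
    and sum: "a + b + c + 1 = v"
  shows "3 + 3 * t + 1 \<le> a \<or> t + t * k + 1 \<le> b \<or> k + 3 * k + 1 \<le> c"
proof (rule ccontr)
  assume neg: "\<not> ?thesis"
  have tk: "3 * t * k = 3 * (t * k)" by simp
  have k: "2 < k"
  proof (rule ccontr)
    assume "\<not> 2 < k"
    then have "t * k \<le> t * 2" by simp
    then show False using v tk by linarith
  qed
  obtain i where i: "t = i + 3" using t le_Suc_ex by (metis add.commute)
  obtain j where j: "k = j + 3" using k by (metis add.commute le_Suc_ex Suc_leI eval_nat_numeral(3))
  define p where "p = i * j"
  have e: "t * k = p + 3 * i + 3 * j + 9" unfolding i j p_def by (simp add: algebra_simps)
  have le: "a \<le> 3 + 3 * t" "b \<le> t + t * k" "c \<le> k + 3 * k" using neg by simp_all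
  show False using v(1)
  proof
    assume "v = 3 * t * k + 1"
    then have "v = 3 * (t * k) + 1" by simp
    then have "p + i + j \<le> 4" "44 \<le> 3 * p + 3 * i + 9 * j"
      using v(2) sum le e i j by linarith+
    then show False by linarith
  next
    assume "v + 1 = 3 * t * k"
    then have "v + 1 = 3 * (t * k)" by simp
    then have "p + i + j \<le> 5" "46 \<le> 3 * p + 3 * i + 9 * j"
      using v(2) sum le e i j by linarith+
    \<comment> \<open>Here \<open>3 p + 3 i + 9 j \<le> 9 (p + i + j) \<le> 45\<close>, one less
      than required: the constant 53 is just large enough.\<close>
    then show False by linarith
  qed
qed

text \<open>Since \<open>3 t k\<close> is \<open>v - 1\<close> or \<open>v + 1\<close>, the factor 3
  is a unit modulo \<open>v\<close> and sends \<open>t k\<close> to length 1. This serves both the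
  threshold for \<open>b\<close> and the ladder for \<open>t = 2\<close>.\<close>

lemma realizable_of_tour_scaled_3:
  fixes t k :: nat
  assumes t: "2 \<le> t" and k: "2 < k" and v: "v = 3 * t * k + 1 \<or> v + 1 = 3 * t * k"
    and T: "tour {0..<int v} u w (replicate_mset b 1 + replicate_mset c t + replicate_mset a (t * k))"
  shows "realizable v (replicate_mset a 1 + replicate_mset b 3 + replicate_mset c (3 * t))"
proof -
  have tk: "t * 3 \<le> t * k" "3 * t * k = 3 * (t * k)" using k by simp_all
  have v6: "6 * t < v" using tk t v by linarith
  have iv: "int v = 3 * int (t * k) + 1 \<or> int v = 3 * int (t * k) - 1" using v unfolding tk(2) by linarith
  have c1: "[3 * int (t * k) = int 1] (mod int v) \<or> [3 * int (t * k) = - int 1] (mod int v)"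
    using iv by (auto simp: cong_iff_dvd_diff)
  have "coprime 3 (int v)"
  proof (rule coprimeI)
    fix d :: int assume "d dvd 3" "d dvd int v"
    then have "d dvd int v - 3 * int (t * k)" by simp
    then show "is_unit d" using iv by auto
  qed
  then have "realizable v (replicate_mset b 3 + replicate_mset c (3 * t) + replicate_mset a 1)"
    using t k v6 c1 by (intro tour_three_imp_realizable[OF T]) auto
  then show ?thesis by (simp add: ac_simps)
qed

text \<open>The length that is frequent enough takes the role of 1 in
  \<open>tour_three_lengths\<close>; the multipliers are 1, 3 and \<open>3 t\<close> in
  turn.\<close>

lemma realizable_by_thresholds:
  fixes t k :: nat
  assumes t: "2 \<le> t" and k: "2 < k" and v: "v = 3 * t * k + 1 \<or> v + 1 = 3 * t * k"
    and sum: "a + b + c + 1 = v"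
    and le: "3 + 3 * t + 1 \<le> a \<or> t + t * k + 1 \<le> b \<or> k + 3 * k + 1 \<le> c"
  shows "realizable v (replicate_mset a 1 + replicate_mset b 3 + replicate_mset c (3 * t))"
proof -
  have tk: "t * 3 \<le> t * k" "3 * t * k = 3 * (t * k)" using k by simp_all
  have v6: "6 * t < v" using tk t v by linarith
  from le show ?thesis
  proof (elim disjE)
    assume "3 + 3 * t + 1 \<le> a"
    then obtain u w where T: "tour {0..<int v} u w
        (replicate_mset a 1 + replicate_mset b 3 + replicate_mset c (3 * t))"
      using tour_three_lengths[of 3 "3 * t" a b c] t sum by auto
    show ?thesis
      using t v6 by (intro tour_three_imp_realizable[OF T, of 1]) auto
  next
    assume "t + t * k + 1 \<le> b"
    moreover have "b + c + a + 1 = v" using sum by simp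
    ultimately obtain u w where "tour {0..<int v} u w
        (replicate_mset b 1 + replicate_mset c t + replicate_mset a (t * k))"
      using tour_three_lengths[of t "t * k" b c a] t k by auto
    then show ?thesis by (rule realizable_of_tour_scaled_3[OF t k v])
  next
    assume "k + 3 * k + 1 \<le> c"
    moreover have "c + a + b + 1 = v" using sum by simp
    ultimately obtain u w where T: "tour {0..<int v} u w
        (replicate_mset c 1 + replicate_mset a k + replicate_mset b (3 * k))"
      using tour_three_lengths[of k "3 * k" c a b] k by auto
    have iv: "int v = int (3 * t) * int k + 1 \<or> int v = int (3 * t) * int k - 1"
      using v by (metis add_diff_cancel_right' of_nat_1 of_nat_add of_nat_mult)
    then have c1: "[int (3 * t) * int k = int 1] (mod int v) \<or> [int (3 * t) * int k = - int 1] (mod int v)"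
      by (auto simp: cong_iff_dvd_diff)
    have c3: "[int (3 * t) * int (3 * k) = int 3] (mod int v) \<or> [int (3 * t) * int (3 * k) = - int 3] (mod int v)"
    proof -
      have "[3 * (int (3 * t) * int k) = 3 * int 1] (mod int v) \<or>
          [3 * (int (3 * t) * int k) = 3 * - int 1] (mod int v)"
        using c1 cong_scalar_left by blast
      then show ?thesis by (simp add: ac_simps)
    qed
    have "coprime (int (3 * t)) (int v)"
    proof (rule coprimeI)
      fix d :: int assume "d dvd int (3 * t)" "d dvd int v"
      then have "d dvd int v - int (3 * t) * int k" by (metis dvd_diff dvd_mult2)
      then show "is_unit d" using iv by auto
    qed
    then have "realizable v (replicate_mset c (3 * t) + replicate_mset a 1 + replicate_mset b 3)"
      using c1 c3 t k v6 by (intro tour_three_imp_realizable[OF T]) auto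
    then show ?thesis by (simp add: ac_simps)
  qed
qed

theorem theorem5p2:
  fixes t v :: nat and L :: "nat multiset"
  assumes "t \<ge> 2"
    and "v > 0"
    and "[int v = 1] (mod int (3 * t)) \<or> [int v = - 1] (mod int (3 * t))"
    and "v > 6 * t + 53"
    and "size L = v - 1"
    and "set_mset L = {1, 3, 3 * t}"
  shows "realizable v L"
proof -
  obtain k where v: "v = 3 * t * k + 1 \<or> v + 1 = 3 * t * k"
  proof -
    have "int (3 * t) dvd int (v - 1) \<or> int (3 * t) dvd int (v + 1)"
      using assms(2,3) by (simp add: cong_iff_dvd_diff add.commute)
    then have "3 * t dvd v - 1 \<or> 3 * t dvd v + 1" by (simp only: int_dvd_int_iff)
    then consider m where "v - 1 = 3 * t * m" | m where "v + 1 = 3 * t * m" by (elim disjE dvdE)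
    then show ?thesis
    proof cases
      case (1 m)
      then have "v = 3 * t * m + 1" using assms(2) by linarith
      then show ?thesis using that by blast
    next
      case (2 m)
      then show ?thesis using that by blast
    qed
  qed
  \<comment> \<open>This gives \<open>6 t < v\<close>, so that even \<open>3 t\<close> is less than
    half of \<open>v\<close>.\<close>
  have k: "2 < k"
  proof (rule ccontr)
    assume "\<not> 2 < k"
    then have "3 * t * k \<le> 3 * t * 2" by simp
    then show False using v assms(4) by linarith
  qed
  define a b c where "a = count L 1" and "b = count L 3" and "c = count L (3 * t)"
  have L: "L = replicate_mset a 1 + replicate_mset b 3 + replicate_mset c (3 * t)"
  proof (rule multiset_eqI)
    fix z
    have "count L z = 0" if "z \<notin> {1, 3, 3 * t}"
      using that assms(6) by (simp add: not_in_iff[symmetric])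
    then show "count L z = count (replicate_mset a 1 + replicate_mset b 3 + replicate_mset c (3 * t)) z"
      using assms(1) unfolding a_def b_def c_def by auto
  qed
  have "size L = a + b + c" by (subst L) simp
  then have sum: "a + b + c + 1 = v" using assms(2,5) by simp
  show ?thesis
  proof (cases "3 + 3 * t + 1 \<le> a \<or> t + t * k + 1 \<le> b \<or> k + 3 * k + 1 \<le> c")
    case True
    then show ?thesis unfolding L by (rule realizable_by_thresholds[OF assms(1) k v sum])
  next
    case False
    then have t2: "t = 2" using threshold_arith[OF _ v assms(4) sum] assms(1) by linarith
    have "a + 2 \<le> 2 * k" "a + 4 \<le> b" "2 * k \<le> c"
    proof -
      have v': "v = 6 * k + 1 \<or> v + 1 = 6 * k" using v unfolding t2 by simp
      have le: "a \<le> 9" "b \<le> 2 * k + 2" "c \<le> 4 * k" using False unfolding t2 by simp_all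
      have "65 < v" using assms(4) unfolding t2 by simp
      \<comment> \<open>With \<open>a \<le> 9\<close> and \<open>c \<le> 4 k\<close>, the condition
        \<open>a + 4 \<le> b\<close> follows from \<open>22 \<le> 2 k\<close> or
        \<open>24 \<le> 2 k\<close> respectively, so these values of \<open>k\<close> just
        suffice.\<close>
      then have k11: "v = 6 * k + 1 \<and> 11 \<le> k \<or> v + 1 = 6 * k \<and> 12 \<le> k" using v' by linarith
      show "a + 2 \<le> 2 * k" "a + 4 \<le> b" "2 * k \<le> c"
        using v' k11 le sum by linarith+
    qed
    then obtain u w where "tour {0..<int (b + c + a + 1)} u w
        (replicate_mset b 1 + replicate_mset c t + replicate_mset a (t * k))"
      using tour_ladder[of "2 * k" a b c] unfolding t2 by auto
    moreover have "b + c + a + 1 = v" using sum by simp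
    ultimately show ?thesis
      unfolding L by (metis realizable_of_tour_scaled_3[OF assms(1) k v])
  qed
qed

end
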